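(* Let $n\ge1$, let $B$ be a finite multiset of elements of $\mathfrak{S}_n$, and let $J\subseteq[n-1]$. If $B$ is symmetric, then the multisets $R_J^{-1}B$ and $BR_J^{-1}$ are also symmetric.
   Context: $[n]=\{1,\dots,n\}$ and $\mathfrak{S}_n$ is the symmetric group on $[n]$; the product is composition, $(\pi\tau)_i=\pi_{\tau_i}$. For $\pi\in\mathfrak{S}_n$, $\mathrm{Des}(\pi)=\{i\in[n-1]:\pi_i>\pi_{i+1}\}$. For $J\subseteq[n-1]$, the inverse $J$-class is $R_J^{-1}=\{\pi^{-1}:\pi\in\mathfrak{S}_n,\ \mathrm{Des}(\pi)\subseteq J\}$. For multisets $A,B$ of elements of $\mathfrak{S}_n$, $AB$ is the multiset of all products $\pi\tau$ with $\pi\in A,\tau\in B$ (with multiplicity). For $J=\{j_1<\dots<j_s\}\subseteq[n-1]$, $\mathrm{co}(J)=(j_1,j_2-j_1,\dots,j_s-j_{s-1},n-j_s)$, a composition of $n$. For a composition $\alpha=(\alpha_1,\dots,\alpha_p)$ of $n$, $M_\alpha=\sum_{i_1<\cdots<i_p}x_{i_1}^{\alpha_1}\cdots x_{i_p}^{\alpha_p}$ (variables $x_1,x_2,\dots$) and $F_\alpha=\sum_{\beta\le\alpha}M_\beta$ over all refinements $\beta$ of $\alpha$ (including $\alpha$). $F_{J,n}:=F_{\mathrm{co}(J)}$ and $Q(B)=\sum_{\pi\in B}F_{\mathrm{Des}(\pi),n}$ (with multiplicity). A multiset $B$ is symmetric if $Q(B)$ is a symmetric function, i.e. invariant under all permutations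 of the variables. *)

theory Defs
  imports
    "HOL-Library.Multiset"
    "HOL-Library.Poly_Mapping"
    "HOL-Combinatorics.Permutations"
begin

text \<open>
  The symmetric group on \<open>[n]\<close> is \<open>{\<pi>. \<pi> permutes {1..n}}\<close> (functions on \<open>nat\<close> fixing everything
  outside \<open>{1..n}\<close>), with \<open>(\<circ>)\<close> as its product and \<open>inv\<close> as its inverse.
\<close>

definition Des :: "nat \<Rightarrow> (nat \<Rightarrow> nat) \<Rightarrow> nat set" where
  "Des n \<pi> = {i \<in> {1..n - 1}. \<pi> i > \<pi> (i + 1)}"

definition inv_J_class :: "nat \<Rightarrow> nat set \<Rightarrow> (nat \<Rightarrow> nat) set" where
  "inv_J_class n J = {inv \<pi> |\<pi>. \<pi> permutes {1..n} \<and> Des n \<pi> \<subseteq> J}"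

lemma finite_inv_J_class: "finite (inv_J_class n J)"
proof -
  have "inv_J_class n J \<subseteq> inv ` {\<pi>. \<pi> permutes {1..n}}"
    by (auto simp: inv_J_class_def)
  then show ?thesis
    by (rule finite_subset) (simp add: finite_permutations)
qed

definition perm_mset_prod ::
    "(nat \<Rightarrow> nat) multiset \<Rightarrow> (nat \<Rightarrow> nat) multiset \<Rightarrow> (nat \<Rightarrow> nat) multiset" where
  "perm_mset_prod A B = (\<Sum>\<pi> \<in># A. {#\<pi> \<circ> \<tau>. \<tau> \<in># B#})"

definition is_composition :: "nat \<Rightarrow> nat list \<Rightarrow> bool" where
  "is_composition n \<alpha> \<longleftrightarrow> (\<forall>a \<in> set \<alpha>. a > 0) \<and> sum_list \<alpha> = n"

definition co :: "nat \<Rightarrow> nat set \<Rightarrow> nat list" where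
  "co n J = (let js = sorted_list_of_set J in map2 (-) (js @ [n]) (0 # js))"

text \<open>\<open>\<beta>\<close> refines \<open>\<alpha>\<close> if \<open>\<alpha>\<close> arises from \<open>\<beta>\<close> by adding up consecutive blocks of parts.\<close>

definition refinements :: "nat list \<Rightarrow> nat list set" where
  "refinements \<alpha> = {\<beta>. is_composition (sum_list \<alpha>) \<beta> \<and>
     (\<exists>bs. \<beta> = concat bs \<and> \<alpha> = map sum_list bs)}"

lemma finite_refinements: "finite (refinements \<alpha>)"
proof -
  have len: "length \<beta> \<le> sum_list \<beta>" if "\<forall>a \<in> set \<beta>. a > 0" for \<beta> :: "nat list"
    using that by (induction \<beta>) auto
  have "refinements \<alpha> \<subseteq> {\<beta>. set \<beta> \<subseteq> {..sum_list \<alpha>} \<and> length \<beta> \<le> sum_list \<alpha>}"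
  proof
    fix \<beta> assume "\<beta> \<in> refinements \<alpha>"
    then have pos: "\<forall>a \<in> set \<beta>. a > 0" and sum: "sum_list \<beta> = sum_list \<alpha>"
      unfolding refinements_def is_composition_def by blast+
    show "\<beta> \<in> {\<beta>. set \<beta> \<subseteq> {..sum_list \<alpha>} \<and> length \<beta> \<le> sum_list \<alpha>}"
      using len[OF pos] member_le_sum_list[of _ \<beta>] by (auto simp flip: sum)
  qed
  then show ?thesis
    by (rule finite_subset) (simp add: finite_lists_length_le)
qed

text \<open>
  A formal power series in countably many variables is given by its coefficient function on
  monomials, a monomial being a finitely supported exponent vector. Variables are indexed by
  \<open>nat\<close>, so index \<open>i\<close> stands for \<open>x\<^sub>i\<^sub>+\<^sub>1\<close>; only the order of the variables matters.
\<close>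

type_synonym monomial = "nat \<Rightarrow>\<^sub>0 nat"
type_synonym power_series = "monomial \<Rightarrow> int"

definition monomial_of :: "nat list \<Rightarrow> nat list \<Rightarrow> monomial" where
  "monomial_of \<alpha> ixs = (\<Sum>k<length \<alpha>. Poly_Mapping.single (ixs ! k) (\<alpha> ! k))"

text \<open>
  The coefficient of \<open>m\<close> in \<open>M\<^sub>\<alpha>\<close> is the number of summands (index sequences) equal to \<open>m\<close>. For
  positive parts the indices range over the support of \<open>m\<close>, so the set is finite.
\<close>

definition monomial_qsym :: "nat list \<Rightarrow> power_series" where
  "monomial_qsym \<alpha> m =
     int (card {ixs. length ixs = length \<alpha> \<and> sorted_wrt (<) ixs \<and> monomial_of \<alpha> ixs = m})"

definition fundamental_qsym :: "nat list \<Rightarrow> power_series" where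
  "fundamental_qsym \<alpha> m = (\<Sum>\<beta> \<in> refinements \<alpha>. monomial_qsym \<beta> m)"

definition Q :: "nat \<Rightarrow> (nat \<Rightarrow> nat) multiset \<Rightarrow> power_series" where
  "Q n B m = (\<Sum>\<pi> \<in># B. fundamental_qsym (co n (Des n \<pi>)) m)"

text \<open>
  Replacing each variable \<open>i\<close> by the variable \<open>\<sigma> i\<close> sends the monomial with exponents \<open>m \<circ> \<sigma>\<close> to the one with
  exponents \<open>m\<close>.
\<close>

definition permute_vars :: "(nat \<Rightarrow> nat) \<Rightarrow> power_series \<Rightarrow> power_series" where
  "permute_vars \<sigma> f = (\<lambda>m. f (Poly_Mapping.map_key \<sigma> m))"

definition symmetric_function :: "power_series \<Rightarrow> bool" where
  "symmetric_function f \<longleftrightarrow> (\<forall>\<sigma>. bij \<sigma> \<longrightarrow> permute_vars \<sigma> f = f)"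

definition symmetric_mset :: "nat \<Rightarrow> (nat \<Rightarrow> nat) multiset \<Rightarrow> bool" where
  "symmetric_mset n B \<longleftrightarrow> symmetric_function (Q n B)"

end

theory Submission
  imports Defs "HOL-Library.Product_Lexorder"
begin

text \<open>
  View a monomial of degree \<open>n\<close> as a multiset \<open>X\<close> of \<open>n\<close> letters and write it as a weakly increasing word.
  Its coefficient in the fundamental quasisymmetric function of \<open>Des(\<pi>)\<close> is \<open>1\<close> if \<open>\<pi>\<close> increases along
  every run of equal letters of this word (\<open>\<pi>\<close> is \<^emph>\<open>compatible\<close> with \<open>X\<close>) and \<open>0\<close> otherwise. Hence the
  coefficient of \<open>X\<close> in \<open>Q(B)\<close> is the number of members of \<open>B\<close> compatible with \<open>X\<close>, and \<open>B\<close> is symmetric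
  if and only if this number does not change when the letters of \<open>X\<close> are renamed
  (\<open>symmetric_mset_iff\<close>). It then does not change either if the letters are renamed injectively into
  another linear order (\<open>compatible_count_image_mset\<close>).

  The permutations \<open>\<pi>\<close> with \<open>Des(\<pi>) \<subseteq> J\<close> are those compatible with one multiset \<open>X\<close>, whose runs
  are the blocks cut out by \<open>J\<close>. For \<open>\<tau>\<close> in \<open>B\<close>, the elements \<open>\<sigma>\<close> of the inverse class such that \<open>\<sigma> \<circ> \<tau>\<close>
  is compatible with \<open>Y\<close> therefore correspond to the factorizations \<open>\<tau> = \<pi> \<circ> \<rho>\<close> with \<open>\<pi>\<close> compatible with
  \<open>X\<close> and \<open>\<rho>\<close> compatible with \<open>Y\<close>; for \<open>\<tau> \<circ> \<sigma>\<close> the roles of \<open>X\<close> and \<open>Y\<close> are exchanged.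

  The core is a bijection (\<open>bij_betw_factorizations_tables\<close>) between these factorizations and the
  multisets \<open>F\<close> of pairs of letters that project to \<open>Y\<close> and \<open>X\<close> and with which \<open>\<tau>\<close> is compatible, pairs
  being ordered lexicographically. It is Solomon's rule for products in the descent algebra, in which
  such \<open>F\<close> appear as nonnegative integer matrices with prescribed row and column sums. Summing over \<open>B\<close>,
  the coefficient of \<open>Y\<close> in either product is the sum, over all these \<open>F\<close>, of the number of members of \<open>B\<close>
  compatible with \<open>F\<close> (\<open>compatible_count_prod\<close>). Renaming the letters of \<open>Y\<close> renames one
  component of the pairs in \<open>F\<close>. This is a bijection between the ranges of summation, and it preserves
  each summand because \<open>B\<close> is symmetric. So the coefficients of the products are invariant under
  renaming as well.
\<close>

section \<open>Monomials as words and compatible permutations\<close>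

definition letter :: "'a::linorder multiset \<Rightarrow> nat \<Rightarrow> 'a" where
  "letter X i = sorted_list_of_multiset X ! (i - 1)"

text \<open>
  A monomial of degree \<open>n\<close> is a multiset \<open>X\<close> of \<open>n\<close> letters. Compatibility of a
  permutation \<open>\<tau>\<close> of \<open>{1..n}\<close> is the condition under which the monomial occurs in the fundamental
  quasisymmetric function of \<open>Des(\<tau>)\<close>: the word of \<open>X\<close> in weakly increasing
  order must step up strictly at each descent of \<open>\<tau>\<close>. Comparing arbitrary positions \<open>i < j\<close> instead of
  neighbours saves a chain argument in every later use. The letters may come from any linear order,
  since pairs of letters will be needed as well.
\<close>
definition compatible :: "(nat \<Rightarrow> nat) \<Rightarrow> 'a::linorder multiset \<Rightarrow> bool" where
  "compatible \<tau> X \<longleftrightarrow>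
     (\<forall>i j. 1 \<le> i \<and> i < j \<and> j \<le> size X \<and> letter X i = letter X j \<longrightarrow> \<tau> i < \<tau> j)"

lemma length_sorted_list_of_multiset: "length (sorted_list_of_multiset X) = size X"
  by (metis mset_sorted_list_of_multiset size_mset)

lemma letter_mono: "1 \<le> i \<Longrightarrow> i \<le> j \<Longrightarrow> j \<le> size X \<Longrightarrow> letter X i \<le> letter X j"
  unfolding letter_def
  by (rule sorted_nth_mono) (auto simp: length_sorted_list_of_multiset sorted_sorted_list_of_multiset)

lemma image_mset_letter: "image_mset (letter X) (mset_set {1..size X}) = X"
proof -
  have "map (letter X) [1..<size X + 1] = sorted_list_of_multiset X"
    by (rule nth_equalityI) (auto simp: letter_def length_sorted_list_of_multiset simp del: upt_Suc)
  then have "mset (map (letter X) [1..<size X + 1]) = X"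
    by simp
  moreover have "mset [1..<size X + 1] = mset_set {1..size X}"
    by (simp add: atLeastLessThanSuc_atLeastAtMost del: upt_Suc)
  ultimately show ?thesis
    by (simp del: upt_Suc)
qed

text \<open>
  The word of \<open>X\<close> in weakly increasing order is the only weakly increasing arrangement of \<open>X\<close>; words
  built in other ways are identified with it through this criterion.
\<close>
lemma letter_eqI:
  assumes mono: "\<And>i j. 1 \<le> i \<Longrightarrow> i < j \<Longrightarrow> j \<le> n \<Longrightarrow> f i \<le> f j"
    and X: "image_mset f (mset_set {1..n}) = X" and i: "i \<in> {1..n}"
  shows "letter X i = f i"
proof -
  let ?l = "map f [1..<n + 1]"
  have "mset [1..<n + 1] = mset_set {1..n}"
    by (simp add: atLeastLessThanSuc_atLeastAtMost del: upt_Suc)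
  then have "mset ?l = X"
    using X by (simp del: upt_Suc)
  moreover have "sorted ?l"
    by (auto simp: sorted_iff_nth_mono_less mono simp del: upt_Suc)
  ultimately have "sorted_list_of_multiset X = ?l"
    by (metis sorted_list_of_multiset_mset sorted_sort_id)
  then show ?thesis
    using i by (auto simp: letter_def simp del: upt_Suc)
qed

section \<open>Permutations determined by the order of their values\<close>

text \<open>
  The permutation sends a position to the rank of its key (standardization).
\<close>
lemma permutes_by_key_order:
  fixes key :: "nat \<Rightarrow> 'a::linorder"
  assumes "inj_on key {1..n}"
  obtains \<rho> where "\<rho> permutes {1..n}"
    and "\<And>i j. i \<in> {1..n} \<Longrightarrow> j \<in> {1..n} \<Longrightarrow> \<rho> i < \<rho> j \<longleftrightarrow> key i < key j"
proof
  define \<rho> where "\<rho> i = (if i \<in> {1..n} then card {k \<in> {1..n}. key k \<le> key i} else i)" for i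
  have le: "\<rho> i \<le> \<rho> j" if "i \<in> {1..n}" "j \<in> {1..n}" "key i \<le> key j" for i j
    using that by (auto simp: \<rho>_def intro!: card_mono)
  have less: "\<rho> i < \<rho> j" if "i \<in> {1..n}" "j \<in> {1..n}" "key i < key j" for i j
  proof -
    have "{k \<in> {1..n}. key k \<le> key i} \<subseteq> {k \<in> {1..n}. key k \<le> key j}"
      using that by auto
    moreover have "j \<in> {k \<in> {1..n}. key k \<le> key j} - {k \<in> {1..n}. key k \<le> key i}"
      using that by auto
    ultimately have "{k \<in> {1..n}. key k \<le> key i} \<subset> {k \<in> {1..n}. key k \<le> key j}"
      by blast
    then show ?thesis
      using that by (simp add: \<rho>_def psubset_card_mono)
  qed
  show iff: "\<rho> i < \<rho> j \<longleftrightarrow> key i < key j" if "i \<in> {1..n}" "j \<in> {1..n}" for i j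
    using le less that by (meson leD leI)
  have inj: "inj_on \<rho> {1..n}"
    using assms less by (intro inj_onI) (metis inj_onD less_irrefl neqE)
  have "\<rho> i \<in> {1..n}" if "i \<in> {1..n}" for i
  proof -
    have "card {k \<in> {1..n}. key k \<le> key i} \<le> card {1..n}"
      by (intro card_mono) auto
    moreover have "card {k \<in> {1..n}. key k \<le> key i} > 0"
      using that by (subst card_gt_0_iff) auto
    ultimately show ?thesis
      using that by (simp add: \<rho>_def)
  qed
  then have "bij_betw \<rho> {1..n} {1..n}"
    using inj unfolding bij_betw_def by (metis endo_inj_surj finite_atLeastAtMost image_subsetI)
  then show "\<rho> permutes {1..n}"
    by (rule bij_imp_permutes) (auto simp: \<rho>_def)
qed

text \<open>
  The value of a permutation at \<open>i\<close> is one more than the number of smaller values, and this number can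
  be read off from the order of the values.
\<close>
lemma permutes_eqI_order:
  fixes \<rho> \<rho>' :: "nat \<Rightarrow> nat"
  assumes \<rho>: "\<rho> permutes {1..n}" and \<rho>': "\<rho>' permutes {1..n}"
    and iff: "\<And>i j. i \<in> {1..n} \<Longrightarrow> j \<in> {1..n} \<Longrightarrow> \<rho> i < \<rho> j \<longleftrightarrow> \<rho>' i < \<rho>' j"
  shows "\<rho> = \<rho>'"
proof
  fix i
  have rank: "\<pi> i = Suc (card {j \<in> {1..n}. \<pi> j < \<pi> i})" if "\<pi> permutes {1..n}" "i \<in> {1..n}"
    for \<pi> :: "nat \<Rightarrow> nat"
  proof -
    have "\<pi> ` {j \<in> {1..n}. \<pi> j < \<pi> i} = {1..<\<pi> i}"
    proof (intro equalityI subsetI)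
      fix y assume y: "y \<in> {1..<\<pi> i}"
      moreover have "\<pi> i \<in> {1..n}"
        using that permutes_in_image[OF that(1)] by simp
      ultimately have "y \<in> \<pi> ` {1..n}"
        using permutes_image[OF that(1)] by simp
      then show "y \<in> \<pi> ` {j \<in> {1..n}. \<pi> j < \<pi> i}"
        using y by auto
    next
      fix y assume "y \<in> \<pi> ` {j \<in> {1..n}. \<pi> j < \<pi> i}"
      then show "y \<in> {1..<\<pi> i}"
        using permutes_in_image[OF that(1)] by auto
    qed
    moreover have "card (\<pi> ` {j \<in> {1..n}. \<pi> j < \<pi> i}) = card {j \<in> {1..n}. \<pi> j < \<pi> i}"
      by (rule card_image) (rule permutes_inj_on[OF that(1)])
    moreover have "\<pi> i \<in> {1..n}"
      using that permutes_in_image[OF that(1)] by simp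
    ultimately have "card {j \<in> {1..n}. \<pi> j < \<pi> i} = \<pi> i - 1" "\<pi> i > 0"
      by simp_all
    then show ?thesis
      by linarith
  qed
  show "\<rho> i = \<rho>' i"
  proof (cases "i \<in> {1..n}")
    case True
    then have "{j \<in> {1..n}. \<rho> j < \<rho> i} = {j \<in> {1..n}. \<rho>' j < \<rho>' i}"
      using iff by blast
    then show ?thesis
      using rank[OF \<rho> True] rank[OF \<rho>' True] by simp
  next
    case False
    then show ?thesis
      using \<rho> \<rho>' by (simp add: permutes_not_in)
  qed
qed

section \<open>Factorizations and contingency tables\<close>

text \<open>
  A two-line array, the word of \<open>Y\<close> above the word of \<open>X\<close> rearranged by \<open>\<rho>\<close>, with the order of its
  columns forgotten; \<open>letter_table\<close> shows how to recover the order.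
\<close>
definition table :: "nat \<Rightarrow> 'a::linorder multiset \<Rightarrow> 'b::linorder multiset \<Rightarrow> (nat \<Rightarrow> nat) \<Rightarrow> ('b \<times> 'a) multiset"
  where "table n X Y \<rho> = image_mset (\<lambda>i. (letter Y i, letter X (\<rho> i))) (mset_set {1..n})"

definition factorizations ::
    "nat \<Rightarrow> (nat \<Rightarrow> nat) \<Rightarrow> 'a::linorder multiset \<Rightarrow> 'b::linorder multiset \<Rightarrow> ((nat \<Rightarrow> nat) \<times> (nat \<Rightarrow> nat)) set"
  where "factorizations n \<tau> X Y = {(\<pi>, \<rho>). \<pi> permutes {1..n} \<and> \<rho> permutes {1..n} \<and>
    \<pi> \<circ> \<rho> = \<tau> \<and> compatible \<pi> X \<and> compatible \<rho> Y}"

text \<open>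
  A multiset of pairs is a matrix of nonnegative integers (the multiplicity of each pair); fixing its
  two projections fixes the row sums and the column sums.
\<close>
definition contingency_tables :: "'a multiset \<Rightarrow> 'b multiset \<Rightarrow> ('b \<times> 'a) multiset set" where
  "contingency_tables X Y = {F. image_mset fst F = Y \<and> image_mset snd F = X}"

lemma image_mset_permutes:
  assumes "\<rho> permutes {1..n}"
  shows "image_mset (\<lambda>i. f (\<rho> i)) (mset_set {1..n}) = image_mset f (mset_set {1..n})"
proof -
  have "image_mset \<rho> (mset_set {1..n}) = mset_set {1..n}"
    using assms by (simp add: image_mset_mset_set permutes_inj_on permutes_image)
  then show ?thesis
    by (metis (no_types, lifting) image_mset.compositionality comp_def image_mset_cong)
qed

text \<open>
  Compatibility of \<open>\<rho>\<close> with \<open>Y\<close> makes the word of pairs lexicographically increasing: along a run of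
  equal letters of \<open>Y\<close> the values of \<open>\<rho>\<close> increase, and so do the letters of \<open>X\<close> at these values.
\<close>
lemma letter_table:
  assumes n: "size X = n" "size Y = n" and \<rho>: "\<rho> permutes {1..n}" "compatible \<rho> Y"
    and i: "i \<in> {1..n}"
  shows "letter (table n X Y \<rho>) i = (letter Y i, letter X (\<rho> i))"
proof (rule letter_eqI[OF _ _ i])
  fix i j :: nat
  assume ij: "1 \<le> i" "i < j" "j \<le> n"
  have le: "letter Y i \<le> letter Y j"
    using ij n by (intro letter_mono) auto
  have "letter X (\<rho> i) \<le> letter X (\<rho> j)" if "letter Y i = letter Y j"
  proof -
    have "\<rho> i < \<rho> j"
      using \<rho>(2) ij that n by (auto simp: compatible_def)
    moreover have "\<rho> i \<in> {1..n}" "\<rho> j \<in> {1..n}"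
      using permutes_in_image[OF \<rho>(1)] ij by auto
    ultimately show ?thesis
      using n by (intro letter_mono) auto
  qed
  then show "(letter Y i, letter X (\<rho> i)) \<le> (letter Y j, letter X (\<rho> j))"
    using le by (auto simp: less_eq_prod_def order.strict_iff_order)
qed (simp add: table_def)

lemma table_mem_contingency_tables:
  assumes "size X = n" "size Y = n" "\<rho> permutes {1..n}"
  shows "table n X Y \<rho> \<in> contingency_tables X Y"
  using assms image_mset_letter[of X] image_mset_letter[of Y]
    image_mset_permutes[OF assms(3), of "letter X"]
  by (simp add: contingency_tables_def table_def multiset.map_comp comp_def)

text \<open>
  The key to reconstructing a factorization \<open>\<tau> = \<pi> \<circ> \<rho>\<close> from its table: if \<open>\<pi>\<close> is compatible with \<open>X\<close>,
  then \<open>\<rho>\<close> sorts the positions by the letter of \<open>X\<close>, ties being broken by the value of \<open>\<pi> \<circ> \<rho>\<close>. Thus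
  \<open>\<rho>\<close> is determined by \<open>\<tau>\<close> and the lower word of the table.
\<close>
lemma compatible_order_iff:
  assumes n: "size X = n"
    and \<pi>: "\<pi> permutes {1..n}" "compatible \<pi> X" and \<rho>: "\<rho> permutes {1..n}"
    and ij: "i \<in> {1..n}" "j \<in> {1..n}"
  shows "\<rho> i < \<rho> j \<longleftrightarrow> (letter X (\<rho> i), \<pi> (\<rho> i)) < (letter X (\<rho> j), \<pi> (\<rho> j))"
proof -
  have less: "(letter X (\<rho> i), \<pi> (\<rho> i)) < (letter X (\<rho> j), \<pi> (\<rho> j))"
    if "i \<in> {1..n}" "j \<in> {1..n}" "\<rho> i < \<rho> j" for i j
  proof -
    have "\<rho> i \<in> {1..n}" "\<rho> j \<in> {1..n}"
      using permutes_in_image[OF \<rho>] that by auto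
    then have "letter X (\<rho> i) \<le> letter X (\<rho> j)" "letter X (\<rho> i) = letter X (\<rho> j) \<longrightarrow> \<pi> (\<rho> i) < \<pi> (\<rho> j)"
      using that n \<pi>(2) by (auto intro!: letter_mono simp: compatible_def)
    then show ?thesis
      by (auto simp: less_prod_def)
  qed
  have "i = j" if "\<rho> i = \<rho> j"
    using that permutes_inj[OF \<rho>] by (simp add: inj_eq)
  then show ?thesis
    using less[OF ij] less[OF ij(2,1)] by (metis less_asym less_irrefl neqE)
qed

text \<open>
  This is the multiplication rule of Solomon's descent algebra, coefficient by coefficient. Positions
  \<open>i < j\<close> with equal pairs satisfy \<open>\<rho> i < \<rho> j\<close> by compatibility of \<open>\<rho>\<close>, hence \<open>\<tau> i < \<tau> j\<close> by compatibility
  of \<open>\<pi>\<close>; so \<open>\<tau>\<close> is compatible with the table. Conversely, from \<open>\<tau>\<close> and a compatible table the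
  permutation \<open>\<rho>\<close> is recovered by sorting the positions by the second component, ties broken by \<open>\<tau>\<close>.
\<close>
lemma bij_betw_factorizations_tables:
  assumes n: "size X = n" "size Y = n" and \<tau>: "\<tau> permutes {1..n}"
  shows "bij_betw (\<lambda>(\<pi>, \<rho>). table n X Y \<rho>)
    (factorizations n \<tau> X Y) {F \<in> contingency_tables X Y. compatible \<tau> F}"
proof (rule bij_betw_imageI)
  show "inj_on (\<lambda>(\<pi>, \<rho>). table n X Y \<rho>) (factorizations n \<tau> X Y)"
  proof (rule inj_onI, clarsimp)
    fix \<pi> \<rho> \<pi>' \<rho>'
    assume mem: "(\<pi>, \<rho>) \<in> factorizations n \<tau> X Y" "(\<pi>', \<rho>') \<in> factorizations n \<tau> X Y"
      and eq: "table n X Y \<rho> = table n X Y \<rho>'"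
    have \<rho>: "\<rho> permutes {1..n}" "compatible \<rho> Y" "\<rho>' permutes {1..n}" "compatible \<rho>' Y"
      and \<pi>: "\<pi> permutes {1..n}" "compatible \<pi> X" "\<pi>' permutes {1..n}" "compatible \<pi>' X"
      and prod: "\<pi> \<circ> \<rho> = \<tau>" "\<pi>' \<circ> \<rho>' = \<tau>"
      using mem by (auto simp: factorizations_def)
    have "letter X (\<rho> i) = letter X (\<rho>' i)" if "i \<in> {1..n}" for i
      using letter_table[OF n \<rho>(1,2) that] letter_table[OF n \<rho>(3,4) that] eq by simp
    moreover have "\<pi> (\<rho> i) = \<pi>' (\<rho>' i)" for i
      using prod by (metis comp_apply)
    ultimately have "\<rho> i < \<rho> j \<longleftrightarrow> \<rho>' i < \<rho>' j" if "i \<in> {1..n}" "j \<in> {1..n}" for i j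
      unfolding compatible_order_iff[OF n(1) \<pi>(1,2) \<rho>(1) that]
        compatible_order_iff[OF n(1) \<pi>(3,4) \<rho>(3) that]
      using that by simp
    then have "\<rho> = \<rho>'"
      by (rule permutes_eqI_order[OF \<rho>(1,3)])
    moreover have "\<pi> = \<pi>'"
      using prod \<open>\<rho> = \<rho>'\<close> \<rho>(1) by (metis comp_assoc comp_id permutes_inv_o(1))
    ultimately show "\<pi> = \<pi>' \<and> \<rho> = \<rho>'"
      by simp
  qed
next
  show "(\<lambda>(\<pi>, \<rho>). table n X Y \<rho>) ` factorizations n \<tau> X Y = {F \<in> contingency_tables X Y. compatible \<tau> F}"
  proof (intro equalityI subsetI)
    fix F
    assume "F \<in> (\<lambda>(\<pi>, \<rho>). table n X Y \<rho>) ` factorizations n \<tau> X Y"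
    then obtain \<pi> \<rho> where F: "F = table n X Y \<rho>" and mem: "(\<pi>, \<rho>) \<in> factorizations n \<tau> X Y"
      by auto
    have \<rho>: "\<rho> permutes {1..n}" "compatible \<rho> Y" and \<pi>: "\<pi> permutes {1..n}" "compatible \<pi> X"
      and prod: "\<tau> = \<pi> \<circ> \<rho>"
      using mem by (auto simp: factorizations_def)
    have "\<tau> i < \<tau> j" if "1 \<le> i" "i < j" "j \<le> n" "letter F i = letter F j" for i j
    proof -
      have ij: "i \<in> {1..n}" "j \<in> {1..n}"
        using that by auto
      have eq: "letter Y i = letter Y j" "letter X (\<rho> i) = letter X (\<rho> j)"
        using that(4) letter_table[OF n \<rho> ij(1)] letter_table[OF n \<rho> ij(2)] F by auto
      then have "\<rho> i < \<rho> j"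
        using that \<rho>(2) n by (auto simp: compatible_def)
      then show ?thesis
        using compatible_order_iff[OF n(1) \<pi> \<rho>(1) ij] eq prod by (simp add: less_prod_def)
    qed
    moreover have "size F = n"
      by (simp add: F table_def)
    ultimately show "F \<in> {F \<in> contingency_tables X Y. compatible \<tau> F}"
      using table_mem_contingency_tables[OF n \<rho>(1)] F by (auto simp: compatible_def)
  next
    fix F
    assume "F \<in> {F \<in> contingency_tables X Y. compatible \<tau> F}"
    then have F: "image_mset fst F = Y" "image_mset snd F = X" "compatible \<tau> F"
      by (auto simp: contingency_tables_def)
    have size_F: "size F = n"
      using F(1) n by auto
    have image_F: "image_mset (letter F) (mset_set {1..n}) = F"
      using image_mset_letter[of F] size_F by simp
    have F_mono: "letter F i \<le> letter F j" if "1 \<le> i" "i \<le> j" "j \<le> n" for i j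
      using that size_F by (intro letter_mono) auto
    define g where "g i = snd (letter F i)" for i
    have fst_F: "letter Y i = fst (letter F i)" if "i \<in> {1..n}" for i
    proof (rule letter_eqI[OF _ _ that])
      show "image_mset (\<lambda>i. fst (letter F i)) (mset_set {1..n}) = Y"
        using arg_cong[OF image_F, of "image_mset fst"] F(1)
        by (simp add: multiset.map_comp comp_def)
      fix i j :: nat assume "1 \<le> i" "i < j" "j \<le> n"
      then show "fst (letter F i) \<le> fst (letter F j)"
        using F_mono[of i j] by (auto simp: less_eq_prod_def)
    qed
    have image_g: "image_mset g (mset_set {1..n}) = X"
      using arg_cong[OF image_F, of "image_mset snd"] F(2)
      by (simp add: multiset.map_comp comp_def g_def[abs_def])
    \<comment> \<open>the inverse construction: \<open>\<rho>\<close> is the standardization of the lower word with respect to \<open>\<tau>\<close>\<close>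
    have "inj_on (\<lambda>i. (g i, \<tau> i)) {1..n}"
      using permutes_inj_on[OF \<tau>] by (auto simp: inj_on_def)
    then obtain \<rho> where \<rho>: "\<rho> permutes {1..n}" and order:
      "\<And>i j. i \<in> {1..n} \<Longrightarrow> j \<in> {1..n} \<Longrightarrow> \<rho> i < \<rho> j \<longleftrightarrow> (g i, \<tau> i) < (g j, \<tau> j)"
      by (rule permutes_by_key_order) blast
    define \<pi> where "\<pi> = \<tau> \<circ> inv \<rho>"
    have \<rho>': "inv \<rho> permutes {1..n}"
      using \<rho> by (rule permutes_inv)
    have in_range: "inv \<rho> k \<in> {1..n}" if "k \<in> {1..n}" for k
      using permutes_in_image[OF \<rho>'] that by blast
    have \<rho>_inv: "\<rho> (inv \<rho> k) = k" "inv \<rho> (\<rho> k) = k" for k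
      using permutes_inverses[OF \<rho>] by auto
    have sorted_order: "(g (inv \<rho> k), \<pi> k) < (g (inv \<rho> l), \<pi> l)" if "1 \<le> k" "k < l" "l \<le> n" for k l
      using order[of "inv \<rho> k" "inv \<rho> l"] in_range that by (simp add: \<rho>_inv \<pi>_def)
    \<comment> \<open>read in the order given by \<open>\<rho>\<close>, the lower word is weakly increasing, hence the word of \<open>X\<close>\<close>
    have g_inv: "letter X k = g (inv \<rho> k)" if "k \<in> {1..n}" for k
    proof (rule letter_eqI[OF _ _ that])
      show "image_mset (\<lambda>k. g (inv \<rho> k)) (mset_set {1..n}) = X"
        using image_mset_permutes[OF \<rho>', of g] image_g by simp
      fix k l :: nat assume "1 \<le> k" "k < l" "l \<le> n"
      then show "g (inv \<rho> k) \<le> g (inv \<rho> l)"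
        using sorted_order[of k l] by (auto simp: less_prod_def)
    qed
    have "compatible \<pi> X"
      unfolding compatible_def
    proof (intro allI impI, elim conjE)
      fix k l :: nat assume kl: "1 \<le> k" "k < l" "l \<le> size X" "letter X k = letter X l"
      then show "\<pi> k < \<pi> l"
        using sorted_order[of k l] n g_inv[of k] g_inv[of l] by (auto simp: less_prod_def)
    qed
    moreover have "compatible \<rho> Y"
      unfolding compatible_def
    proof (intro allI impI, elim conjE)
      fix i j :: nat assume ij: "1 \<le> i" "i < j" "j \<le> size Y" "letter Y i = letter Y j"
      have "letter F i \<le> letter F j" "fst (letter F i) = fst (letter F j)"
        using F_mono[of i j] fst_F[of i] fst_F[of j] ij n by auto
      then have "g i < g j \<or> letter F i = letter F j \<and> g i = g j"
        by (auto simp: g_def less_eq_prod_def prod_eq_iff)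
      then have "(g i, \<tau> i) < (g j, \<tau> j)"
        using F(3) ij size_F n by (auto simp: compatible_def less_prod_def)
      then show "\<rho> i < \<rho> j"
        using order ij n by auto
    qed
    moreover have "\<pi> permutes {1..n}"
      unfolding \<pi>_def using \<rho>' \<tau> by (rule permutes_compose)
    moreover have "\<pi> \<circ> \<rho> = \<tau>"
      by (rule ext) (simp add: \<pi>_def \<rho>_inv)
    ultimately have "(\<pi>, \<rho>) \<in> factorizations n \<tau> X Y"
      using \<rho> by (simp add: factorizations_def)
    moreover have "table n X Y \<rho> = F"
    proof -
      have "(letter Y i, letter X (\<rho> i)) = letter F i" if "i \<in> {1..n}" for i
        using that fst_F[OF that] g_inv[of "\<rho> i"] permutes_in_image[OF \<rho>, of i] 
        by (simp add: \<rho>_inv g_def)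
      then have "table n X Y \<rho> = image_mset (letter F) (mset_set {1..n})"
        unfolding table_def by (intro image_mset_cong) simp
      then show ?thesis
        using image_F by simp
    qed
    ultimately show "F \<in> (\<lambda>(\<pi>, \<rho>). table n X Y \<rho>) ` factorizations n \<tau> X Y"
      by force
  qed
qed

text \<open>
  If the members of \<open>B\<close> are permutations of \<open>{1..size X}\<close>, this is the coefficient of the monomial \<open>X\<close>
  in \<open>Q(B)\<close>; see \<open>Q_eq_compatible_count\<close>.
\<close>
definition compatible_count :: "(nat \<Rightarrow> nat) multiset \<Rightarrow> 'a::linorder multiset \<Rightarrow> nat" where
  "compatible_count B X = size {#\<tau> \<in># B. compatible \<tau> X#}"

lemma finite_contingency_tables: "finite (contingency_tables X Y)"
proof -
  have "contingency_tables X Y \<subseteq>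
      mset ` {xs. set xs \<subseteq> set_mset Y \<times> set_mset X \<and> length xs = size Y}"
  proof
    fix F
    assume F: "F \<in> contingency_tables X Y"
    obtain xs where xs: "mset xs = F"
      using ex_mset by blast
    then have "set xs \<subseteq> set_mset Y \<times> set_mset X" "length xs = size Y"
      using F by (force simp: contingency_tables_def)+
    then show "F \<in> mset ` {xs. set xs \<subseteq> set_mset Y \<times> set_mset X \<and> length xs = size Y}"
      using xs by blast
  qed
  then show ?thesis
    by (rule finite_subset) (simp add: finite_lists_length_eq)
qed

lemma sum_mset_card_filter_swap:
  assumes "finite S"
  shows "(\<Sum>\<tau> \<in># B. card {x \<in> S. P \<tau> x}) = (\<Sum>x \<in> S. size {#\<tau> \<in># B. P \<tau> x#})"
proof (induction B)
  case (add \<tau> B)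
  have "card {x \<in> S. P \<tau> x} = (\<Sum>x \<in> S. if P \<tau> x then 1 else 0)"
    using assms by (simp add: sum.If_cases Int_def)
  then show ?case
    using add by (simp add: sum.distrib[symmetric] if_distrib cong: if_cong) (rule sum.cong; simp)
qed simp

text \<open>
  Both sides count the pairs of a member \<open>\<tau>\<close> of \<open>B\<close> and a table compatible with \<open>\<tau>\<close>.
\<close>
lemma sum_card_factorizations:
  assumes "size X = n" "size Y = n" and "\<forall>\<tau> \<in># B. \<tau> permutes {1..n}"
  shows "(\<Sum>\<tau> \<in># B. card (factorizations n \<tau> X Y)) =
    (\<Sum>F \<in> contingency_tables X Y. compatible_count B F)"
proof -
  have "(\<Sum>\<tau> \<in># B. card (factorizations n \<tau> X Y)) =
      (\<Sum>\<tau> \<in># B. card {F \<in> contingency_tables X Y. compatible \<tau> F})"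
    using assms bij_betw_same_card[OF bij_betw_factorizations_tables[OF assms(1,2)]]
    by (intro arg_cong[where f = sum_mset] image_mset_cong) simp
  then show ?thesis
    by (simp add: sum_mset_card_filter_swap finite_contingency_tables compatible_count_def)
qed

section \<open>Inverse descent classes\<close>

lemma permutes_less_of_not_Des:
  assumes \<pi>: "\<pi> permutes {1..n}" and ij: "1 \<le> i" "i < j" "j \<le> n"
    and asc: "\<And>k. i \<le> k \<Longrightarrow> k < j \<Longrightarrow> k \<notin> Des n \<pi>"
  shows "\<pi> i < \<pi> j"
proof -
  have step: "\<pi> k < \<pi> (Suc k)" if "i \<le> k" "Suc k \<le> j" for k
  proof -
    have "\<pi> k \<noteq> \<pi> (Suc k)"
      using permutes_inj[OF \<pi>] by (simp add: inj_eq)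
    then show ?thesis
      using asc[of k] that ij by (auto simp: Des_def)
  qed
  have "\<pi> i < \<pi> j'" if "Suc i \<le> j'" "j' \<le> j" for j'
    using that
  proof (induction rule: dec_induct)
    case base
    then show ?case
      using step by simp
  next
    case (step k)
    then show ?case
      using \<open>\<And>k. i \<le> k \<Longrightarrow> Suc k \<le> j \<Longrightarrow> \<pi> k < \<pi> (Suc k)\<close>[of k] by simp
  qed
  then show ?thesis
    using ij by simp
qed

text \<open>
  A weakly increasing word is constant between two positions with equal letters. If it steps up at
  every descent, there is no descent between them.
\<close>
lemma compatible_iff_Des:
  assumes \<pi>: "\<pi> permutes {1..n}" and n: "size X = n"
  shows "compatible \<pi> X \<longleftrightarrow> (\<forall>i \<in> Des n \<pi>. letter X i \<noteq> letter X (i + 1))"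
proof
  assume "compatible \<pi> X"
  then show "\<forall>i \<in> Des n \<pi>. letter X i \<noteq> letter X (i + 1)"
    using n by (fastforce simp: compatible_def Des_def)
next
  assume Des: "\<forall>i \<in> Des n \<pi>. letter X i \<noteq> letter X (i + 1)"
  show "compatible \<pi> X"
    unfolding compatible_def
  proof (intro allI impI, elim conjE)
    fix i j assume ij: "1 \<le> i" "i < j" "j \<le> size X" and eq: "letter X i = letter X j"
    have "k \<notin> Des n \<pi>" if "i \<le> k" "k < j" for k
    proof -
      have "letter X i \<le> letter X k" "letter X k \<le> letter X (k + 1)" "letter X (k + 1) \<le> letter X j"
        using ij that by (auto intro!: letter_mono)
      then show ?thesis
        using eq Des by auto
    qed
    then show "\<pi> i < \<pi> j"
      using permutes_less_of_not_Des[OF \<pi> ij(1,2)] ij(3) n by simp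
  qed
qed

text \<open>
  Take the number of elements of \<open>J\<close> below \<open>i\<close> as the letter at position \<open>i\<close>; then the word steps up
  exactly at the positions in \<open>J\<close>.
\<close>
lemma ex_compatible_iff_Des_subset:
  assumes "J \<subseteq> {1..n - 1}"
  obtains X :: "nat multiset" where "size X = n"
    and "\<And>\<pi>. \<pi> permutes {1..n} \<Longrightarrow> Des n \<pi> \<subseteq> J \<longleftrightarrow> compatible \<pi> X"
proof
  define f where "f i = card (J \<inter> {..<i})" for i
  define X where "X = image_mset f (mset_set {1..n})"
  show n: "size X = n"
    by (simp add: X_def)
  have letter: "letter X i = f i" if "i \<in> {1..n}" for i
    using that by (intro letter_eqI[where n = n and f = f]) (auto simp: X_def f_def intro!: card_mono)
  have "letter X i = letter X (i + 1) \<longleftrightarrow> i \<notin> J" if "i \<in> {1..n - 1}" for i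
  proof -
    have "J \<inter> {..<i + 1} = (if i \<in> J then insert i (J \<inter> {..<i}) else J \<inter> {..<i})"
      by (auto simp: less_Suc_eq)
    then have "f (i + 1) = f i + (if i \<in> J then 1 else 0)"
      by (simp add: f_def)
    moreover have "i \<in> {1..n}" "i + 1 \<in> {1..n}"
      using that by auto
    ultimately show ?thesis
      using letter by (cases "i \<in> J") auto
  qed
  moreover have "Des n \<pi> \<subseteq> {1..n - 1}" for \<pi>
    by (auto simp: Des_def)
  ultimately show "Des n \<pi> \<subseteq> J \<longleftrightarrow> compatible \<pi> X" if "\<pi> permutes {1..n}" for \<pi>
    unfolding compatible_iff_Des[OF that n] by blast
qed

lemma size_filter_perm_mset_prod_left:
  assumes "finite R"
  shows "size {#\<pi> \<in># perm_mset_prod (mset_set R) B. P \<pi>#} = (\<Sum>\<tau> \<in># B. card {\<sigma> \<in> R. P (\<sigma> \<circ> \<tau>)})"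
proof -
  have "size {#\<pi> \<in># perm_mset_prod A B. P \<pi>#} = (\<Sum>\<sigma> \<in># A. size {#\<tau> \<in># B. P (\<sigma> \<circ> \<tau>)#})" for A
    by (induction A) (simp_all add: perm_mset_prod_def filter_mset_image_mset comp_def)
  then show ?thesis
    using assms by (simp add: sum_mset_card_filter_swap sum_unfold_sum_mset)
qed

lemma size_filter_perm_mset_prod_right:
  assumes "finite R"
  shows "size {#\<pi> \<in># perm_mset_prod B (mset_set R). P \<pi>#} = (\<Sum>\<tau> \<in># B. card {\<sigma> \<in> R. P (\<tau> \<circ> \<sigma>)})"
  using assms by (induction B) (simp_all add: perm_mset_prod_def filter_mset_image_mset)

text \<open>
  With \<open>\<pi> = inv \<sigma>\<close> and \<open>\<rho> = \<sigma> \<circ> \<tau>\<close>, membership of \<open>\<sigma>\<close> in the inverse class and compatibility of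
  \<open>\<sigma> \<circ> \<tau>\<close> become the two conditions on a factorization \<open>\<tau> = \<pi> \<circ> \<rho>\<close>.
\<close>
lemma card_inv_J_class_left:
  assumes X: "\<And>\<pi>. \<pi> permutes {1..n} \<Longrightarrow> Des n \<pi> \<subseteq> J \<longleftrightarrow> compatible \<pi> X"
    and \<tau>: "\<tau> permutes {1..n}"
  shows "card {\<sigma> \<in> inv_J_class n J. compatible (\<sigma> \<circ> \<tau>) Y} = card (factorizations n \<tau> X Y)"
proof (rule bij_betw_same_card)
  show "bij_betw (\<lambda>\<sigma>. (inv \<sigma>, \<sigma> \<circ> \<tau>)) {\<sigma> \<in> inv_J_class n J. compatible (\<sigma> \<circ> \<tau>) Y} (factorizations n \<tau> X Y)"
  proof (rule bij_betw_byWitness[where f' = "\<lambda>(\<pi>, \<rho>). inv \<pi>"])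
    show "\<forall>\<sigma> \<in> {\<sigma> \<in> inv_J_class n J. compatible (\<sigma> \<circ> \<tau>) Y}. (\<lambda>(\<pi>, \<rho>). inv \<pi>) (inv \<sigma>, \<sigma> \<circ> \<tau>) = \<sigma>"
      by (auto simp: inv_J_class_def permutes_inv_inv)
    show "\<forall>p \<in> factorizations n \<tau> X Y. (\<lambda>\<sigma>. (inv \<sigma>, \<sigma> \<circ> \<tau>)) ((\<lambda>(\<pi>, \<rho>). inv \<pi>) p) = p"
      by (auto simp: factorizations_def permutes_inv_inv permutes_inv_o comp_assoc[symmetric])
    show "(\<lambda>\<sigma>. (inv \<sigma>, \<sigma> \<circ> \<tau>)) ` {\<sigma> \<in> inv_J_class n J. compatible (\<sigma> \<circ> \<tau>) Y} \<subseteq> factorizations n \<tau> X Y"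
      using X \<tau> by (auto simp: factorizations_def inv_J_class_def permutes_inv_inv permutes_inv_o
          comp_assoc[symmetric] intro: permutes_compose permutes_inv)
    show "(\<lambda>(\<pi>, \<rho>). inv \<pi>) ` factorizations n \<tau> X Y \<subseteq> {\<sigma> \<in> inv_J_class n J. compatible (\<sigma> \<circ> \<tau>) Y}"
      using X by (auto simp: factorizations_def inv_J_class_def permutes_inv_o comp_assoc[symmetric])
  qed
qed

text \<open>
  Here \<open>\<tau> = (\<tau> \<circ> \<sigma>) \<circ> inv \<sigma>\<close>, so the multisets \<open>X\<close> and \<open>Y\<close> exchange their roles.
\<close>
lemma card_inv_J_class_right:
  assumes X: "\<And>\<pi>. \<pi> permutes {1..n} \<Longrightarrow> Des n \<pi> \<subseteq> J \<longleftrightarrow> compatible \<pi> X"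
    and \<tau>: "\<tau> permutes {1..n}"
  shows "card {\<sigma> \<in> inv_J_class n J. compatible (\<tau> \<circ> \<sigma>) Y} = card (factorizations n \<tau> Y X)"
proof (rule bij_betw_same_card)
  show "bij_betw (\<lambda>\<sigma>. (\<tau> \<circ> \<sigma>, inv \<sigma>)) {\<sigma> \<in> inv_J_class n J. compatible (\<tau> \<circ> \<sigma>) Y} (factorizations n \<tau> Y X)"
  proof (rule bij_betw_byWitness[where f' = "\<lambda>(\<pi>, \<rho>). inv \<rho>"])
    show "\<forall>\<sigma> \<in> {\<sigma> \<in> inv_J_class n J. compatible (\<tau> \<circ> \<sigma>) Y}. (\<lambda>(\<pi>, \<rho>). inv \<rho>) (\<tau> \<circ> \<sigma>, inv \<sigma>) = \<sigma>"
      by (auto simp: inv_J_class_def permutes_inv_inv)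
    show "\<forall>p \<in> factorizations n \<tau> Y X. (\<lambda>\<sigma>. (\<tau> \<circ> \<sigma>, inv \<sigma>)) ((\<lambda>(\<pi>, \<rho>). inv \<rho>) p) = p"
      by (auto simp: factorizations_def permutes_inv_inv permutes_inv_o comp_assoc)
    show "(\<lambda>\<sigma>. (\<tau> \<circ> \<sigma>, inv \<sigma>)) ` {\<sigma> \<in> inv_J_class n J. compatible (\<tau> \<circ> \<sigma>) Y} \<subseteq> factorizations n \<tau> Y X"
      using X \<tau> by (auto simp: factorizations_def inv_J_class_def permutes_inv_inv permutes_inv_o
          comp_assoc intro: permutes_compose permutes_inv)
    show "(\<lambda>(\<pi>, \<rho>). inv \<rho>) ` factorizations n \<tau> Y X \<subseteq> {\<sigma> \<in> inv_J_class n J. compatible (\<tau> \<circ> \<sigma>) Y}"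
      using X by (auto simp: factorizations_def inv_J_class_def permutes_inv_o comp_assoc)
  qed
qed

lemma compatible_count_prod:
  assumes B: "\<forall>\<tau> \<in># B. \<tau> permutes {1..n}" and n: "size X = n" "size Y = n"
    and X: "\<And>\<pi>. \<pi> permutes {1..n} \<Longrightarrow> Des n \<pi> \<subseteq> J \<longleftrightarrow> compatible \<pi> X"
  shows "compatible_count (perm_mset_prod (mset_set (inv_J_class n J)) B) Y =
      (\<Sum>F \<in> contingency_tables X Y. compatible_count B F)"
    and "compatible_count (perm_mset_prod B (mset_set (inv_J_class n J))) Y =
      (\<Sum>F \<in> contingency_tables Y X. compatible_count B F)"
proof -
  have "(\<Sum>\<tau> \<in># B. card {\<sigma> \<in> inv_J_class n J. compatible (\<sigma> \<circ> \<tau>) Y}) =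
      (\<Sum>\<tau> \<in># B. card (factorizations n \<tau> X Y))"
    using B by (intro arg_cong[where f = sum_mset] image_mset_cong card_inv_J_class_left[OF X]) auto
  then show "compatible_count (perm_mset_prod (mset_set (inv_J_class n J)) B) Y =
      (\<Sum>F \<in> contingency_tables X Y. compatible_count B F)"
    unfolding compatible_count_def[of "perm_mset_prod _ _"]
    by (simp add: size_filter_perm_mset_prod_left finite_inv_J_class sum_card_factorizations[OF n B])
  have "(\<Sum>\<tau> \<in># B. card {\<sigma> \<in> inv_J_class n J. compatible (\<tau> \<circ> \<sigma>) Y}) =
      (\<Sum>\<tau> \<in># B. card (factorizations n \<tau> Y X))"
    using B by (intro arg_cong[where f = sum_mset] image_mset_cong card_inv_J_class_right[OF X]) auto
  then show "compatible_count (perm_mset_prod B (mset_set (inv_J_class n J))) Y =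
      (\<Sum>F \<in> contingency_tables Y X. compatible_count B F)"
    unfolding compatible_count_def[of "perm_mset_prod _ _"]
    by (simp add: size_filter_perm_mset_prod_right finite_inv_J_class sum_card_factorizations[OF n(2,1) B])
qed

section \<open>Relabelling the letters\<close>

lemma letter_mem: "i \<in> {1..size X} \<Longrightarrow> letter X i \<in># X"
  using nth_mem[of "i - 1" "sorted_list_of_multiset X"]
  by (auto simp: letter_def length_sorted_list_of_multiset)

lemma letter_image_mset:
  assumes h: "strict_mono_on (set_mset X) h" and i: "i \<in> {1..size X}"
  shows "letter (image_mset h X) i = h (letter X i)"
proof (rule letter_eqI[OF _ _ i])
  show "image_mset (\<lambda>i. h (letter X i)) (mset_set {1..size X}) = image_mset h X"
    using arg_cong[OF image_mset_letter[of X], of "image_mset h"]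
    by (simp add: multiset.map_comp comp_def)
  fix i j :: nat assume ij: "1 \<le> i" "i < j" "j \<le> size X"
  have "letter X i \<in># X" "letter X j \<in># X" "letter X i \<le> letter X j"
    using ij by (auto intro: letter_mem letter_mono)
  then show "h (letter X i) \<le> h (letter X j)"
    by (rule mono_onD[OF strict_mono_on_imp_mono_on[OF h]])
qed

lemma compatible_image_mset:
  assumes h: "strict_mono_on (set_mset X) h"
  shows "compatible \<tau> (image_mset h X) \<longleftrightarrow> compatible \<tau> X"
proof -
  have eq: "letter (image_mset h X) i = letter (image_mset h X) j \<longleftrightarrow> letter X i = letter X j"
    if "1 \<le> i" "i < j" "j \<le> size X" for i j
    using that letter_image_mset[OF h, of i] letter_image_mset[OF h, of j]
      inj_on_eq_iff[OF strict_mono_on_imp_inj_on[OF h]] letter_mem[of i X] letter_mem[of j X] by simp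
  then show ?thesis
    by (simp add: compatible_def cong: conj_cong)
qed

lemma ex_strict_mono_from_lessThan:
  fixes S :: "'a::linorder set"
  assumes "finite S"
  obtains h where "bij_betw h {..<card S} S" and "strict_mono_on {..<card S} h"
proof
  let ?h = "(!) (sorted_list_of_set S)"
  show "bij_betw ?h {..<card S} S"
    by (rule bij_betw_nth) (simp_all add: assms)
  show "strict_mono_on {..<card S} ?h"
  proof (rule strict_mono_onI)
    fix i j assume "j \<in> {..<card S}" "i < j"
    then show "?h i < ?h j"
      by (simp add: sorted_wrt_nth_less[OF strict_sorted_list_of_set])
  qed
qed

text \<open>
  Every word over a linear order has the same runs as a word over an initial segment of the natural
  numbers; this transports statements about monomials to other alphabets.
\<close>
lemma ex_image_mset_lessThan:
  fixes X :: "'a::linorder multiset"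
  obtains h :: "nat \<Rightarrow> 'a" and Z where "X = image_mset h Z" and "set_mset Z = {..<card (set_mset X)}"
    and "strict_mono_on {..<card (set_mset X)} h"
proof -
  let ?N = "{..<card (set_mset X)}"
  obtain h where h: "bij_betw h ?N (set_mset X)" and mono: "strict_mono_on ?N h"
    using ex_strict_mono_from_lessThan[of "set_mset X"] by auto
  define Z where "Z = image_mset (inv_into ?N h) X"
  have "image_mset h Z = image_mset id X"
    unfolding Z_def multiset.map_comp
    by (rule image_mset_cong) (use h bij_betw_inv_into_right in fastforce)
  moreover have "set_mset Z = ?N"
    using bij_betw_imp_surj_on[OF bij_betw_inv_into[OF h]] by (simp add: Z_def)
  ultimately show thesis
    using that[of h Z] mono by simp
qed

text \<open>
  Symmetry of \<open>Q(B)\<close> on the level of coefficients: renaming the variables of a monomial does not change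
  its coefficient.
\<close>
definition rearrangement_invariant :: "nat \<Rightarrow> (nat \<Rightarrow> nat) multiset \<Rightarrow> bool" where
  "rearrangement_invariant n B \<longleftrightarrow>
    (\<forall>\<sigma> :: nat \<Rightarrow> nat. bij \<sigma> \<longrightarrow> (\<forall>X. size X = n \<longrightarrow>
      compatible_count B (image_mset \<sigma> X) = compatible_count B X))"

text \<open>
  The definition of invariance speaks of bijections of the natural numbers only. Coding the letters of
  both multisets monotonically by \<open>0, \<dots>, c - 1\<close> turns an injective relabelling between arbitrary linear
  orders into a permutation of \<open>{0, \<dots>, c - 1}\<close>, and monotone coding does not affect compatibility.
\<close>
lemma compatible_count_image_mset:
  fixes X :: "'a::linorder multiset" and f :: "'a \<Rightarrow> 'b::linorder"
  assumes B: "rearrangement_invariant n B" and n: "size X = n" and f: "inj_on f (set_mset X)"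
  shows "compatible_count B (image_mset f X) = compatible_count B X"
proof -
  define c where "c = card (set_mset X)"
  have c': "card (set_mset (image_mset f X)) = c"
    using f by (simp add: c_def card_image)
  obtain h Z where h: "X = image_mset h Z" "set_mset Z = {..<c}" "strict_mono_on {..<c} h"
    using ex_image_mset_lessThan[of X] unfolding c_def by metis
  obtain h' Z' where h': "image_mset f X = image_mset h' Z'" "set_mset Z' = {..<c}" "strict_mono_on {..<c} h'"
    using ex_image_mset_lessThan[of "image_mset f X"] unfolding c' by metis
  have bij_h: "bij_betw h {..<c} (set_mset X)"
    using h by (simp add: bij_betw_def strict_mono_on_imp_inj_on)
  have "set_mset (image_mset h' Z') = f ` set_mset X"
    by (simp flip: h'(1))
  then have bij_h': "bij_betw h' {..<c} (f ` set_mset X)"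
    using h' by (simp add: bij_betw_def strict_mono_on_imp_inj_on)
  define \<sigma> where "\<sigma> i = (if i < c then inv_into {..<c} h' (f (h i)) else i)" for i
  have "bij_betw (inv_into {..<c} h' \<circ> (f \<circ> h)) {..<c} {..<c}"
    using bij_h bij_h' f by (metis bij_betw_inv_into bij_betw_trans inj_on_imp_bij_betw)
  then have "bij_betw \<sigma> {..<c} {..<c}"
    by (rule iffD1[OF bij_betw_cong, rotated]) (simp add: \<sigma>_def)
  then have "\<sigma> permutes {..<c}"
    by (rule bij_imp_permutes) (simp add: \<sigma>_def)
  then have "bij \<sigma>"
    by (rule permutes_bij)
  have "image_mset h' (image_mset \<sigma> Z) = image_mset (\<lambda>i. f (h i)) Z"
    unfolding multiset.map_comp
  proof (rule image_mset_cong)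
    fix i assume "i \<in># Z"
    then show "(h' \<circ> \<sigma>) i = f (h i)"
      using bij_betw_inv_into_right[OF bij_h', of "f (h i)"] h by (simp add: \<sigma>_def)
  qed
  then have "image_mset h' (image_mset \<sigma> Z) = image_mset h' Z'"
    using h'(1) h(1) by (simp add: multiset.map_comp comp_def)
  moreover have "set_mset (image_mset \<sigma> Z) = {..<c}"
    using \<open>bij_betw \<sigma> {..<c} {..<c}\<close> h(2) by (simp add: bij_betw_def)
  ultimately have "image_mset f X = image_mset h' (image_mset \<sigma> Z)"
    and mono: "strict_mono_on (set_mset (image_mset \<sigma> Z)) h'"
    using h' by simp_all
  then have "compatible_count B (image_mset f X) = compatible_count B (image_mset \<sigma> Z)"
    by (simp add: compatible_count_def compatible_image_mset)
  also have "\<dots> = compatible_count B Z"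
    using B \<open>bij \<sigma>\<close> n h(1) by (simp add: rearrangement_invariant_def)
  also have "\<dots> = compatible_count B X"
    using h by (simp add: compatible_count_def compatible_image_mset)
  finally show ?thesis .
qed

text \<open>
  Relabelling rows and columns is a bijection between the sets of tables. It moves the entries of a
  table, so it changes the order in which they are read, but the invariance of \<open>B\<close> makes this immaterial.
\<close>
lemma sum_contingency_tables_relabel:
  fixes X :: "'a::linorder multiset" and Y :: "'b::linorder multiset" and f :: "'a \<Rightarrow> 'a" and g :: "'b \<Rightarrow> 'b"
  assumes B: "rearrangement_invariant n B" and n: "size Y = n" and f: "bij f" and g: "bij g"
  shows "(\<Sum>F \<in> contingency_tables (image_mset f X) (image_mset g Y). compatible_count B F) =
    (\<Sum>F \<in> contingency_tables X Y. compatible_count B F)"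
proof (rule sum.reindex_bij_witness[where i = "image_mset (map_prod g f)" and j = "image_mset (map_prod (inv g) (inv f))"])
  have inv: "map_prod g f \<circ> map_prod (inv g) (inv f) = id" "map_prod (inv g) (inv f) \<circ> map_prod g f = id"
    "inv f \<circ> f = id" "inv g \<circ> g = id"
    using f g by (auto simp: fun_eq_iff bij_is_inj bij_is_surj surj_f_inv_f)
  fix F
  show "image_mset (map_prod g f) F \<in> contingency_tables (image_mset f X) (image_mset g Y)"
    if "F \<in> contingency_tables X Y"
    using that by (auto simp: contingency_tables_def multiset.map_comp comp_def)
  show "image_mset (map_prod (inv g) (inv f)) (image_mset (map_prod g f) F) = F"
    by (simp add: multiset.map_comp inv)
  assume F: "F \<in> contingency_tables (image_mset f X) (image_mset g Y)"
  then show "image_mset (map_prod g f) (image_mset (map_prod (inv g) (inv f)) F) = F"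
    by (simp add: multiset.map_comp inv)
  have fst: "image_mset fst F = image_mset g Y" and snd: "image_mset snd F = image_mset f X"
    using F by (simp_all add: contingency_tables_def)
  have "image_mset (inv g) (image_mset fst F) = Y" "image_mset (inv f) (image_mset snd F) = X"
    by (simp_all add: fst snd multiset.map_comp inv)
  then show "image_mset (map_prod (inv g) (inv f)) F \<in> contingency_tables X Y"
    by (simp add: contingency_tables_def multiset.map_comp comp_def)
  have "size F = n"
    using arg_cong[OF fst, of size] n by simp
  moreover have "inj_on (map_prod (inv g) (inv f)) (set_mset F)"
    using f g by (intro inj_on_subset[OF map_prod_inj_on[of _ UNIV _ UNIV]] bij_is_inj bij_imp_bij_inv) auto
  ultimately show "compatible_count B (image_mset (map_prod (inv g) (inv f)) F) = compatible_count B F"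
    by (rule compatible_count_image_mset[OF B])
qed

lemma rearrangement_invariant_prod:
  assumes B: "\<forall>\<tau> \<in># B. \<tau> permutes {1..n}" "rearrangement_invariant n B"
    and J: "J \<subseteq> {1..n - 1}"
  shows "rearrangement_invariant n (perm_mset_prod (mset_set (inv_J_class n J)) B)"
    and "rearrangement_invariant n (perm_mset_prod B (mset_set (inv_J_class n J)))"
proof -
  obtain X :: "nat multiset" where n: "size X = n"
    and X: "\<And>\<pi>. \<pi> permutes {1..n} \<Longrightarrow> Des n \<pi> \<subseteq> J \<longleftrightarrow> compatible \<pi> X"
    using ex_compatible_iff_Des_subset[OF J] by blast
  show "rearrangement_invariant n (perm_mset_prod (mset_set (inv_J_class n J)) B)"
    unfolding rearrangement_invariant_def
  proof (intro allI impI)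
    fix \<sigma> :: "nat \<Rightarrow> nat" and Y :: "nat multiset" assume "bij \<sigma>" "size Y = n"
    then show "compatible_count (perm_mset_prod (mset_set (inv_J_class n J)) B) (image_mset \<sigma> Y) =
        compatible_count (perm_mset_prod (mset_set (inv_J_class n J)) B) Y"
      using sum_contingency_tables_relabel[OF B(2) _ bij_id, of Y \<sigma> X]
        compatible_count_prod(1)[OF B(1) n _ X, of Y] compatible_count_prod(1)[OF B(1) n _ X, of "image_mset \<sigma> Y"]
      by simp
  qed
  show "rearrangement_invariant n (perm_mset_prod B (mset_set (inv_J_class n J)))"
    unfolding rearrangement_invariant_def
  proof (intro allI impI)
    fix \<sigma> :: "nat \<Rightarrow> nat" and Y :: "nat multiset" assume "bij \<sigma>" "size Y = n"
    then show "compatible_count (perm_mset_prod B (mset_set (inv_J_class n J))) (image_mset \<sigma> Y) =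
        compatible_count (perm_mset_prod B (mset_set (inv_J_class n J))) Y"
      using sum_contingency_tables_relabel[OF B(2) n _ bij_id, of \<sigma> Y]
        compatible_count_prod(2)[OF B(1) n _ X, of Y] compatible_count_prod(2)[OF B(1) n _ X, of "image_mset \<sigma> Y"]
      by simp
  qed
qed

section \<open>Coefficients of quasisymmetric functions\<close>

text \<open>
  A composition is handled through its partial sums, including the first one, \<open>0\<close>, and the last one, the
  whole sum.
\<close>
definition psums :: "nat list \<Rightarrow> nat set" where
  "psums xs = range (\<lambda>k. sum_list (take k xs))"

text \<open>
  The counterpart of \<open>psums\<close> for a monomial: the numbers of letters that precede a given letter. Taking
  all \<open>a\<close>, not only those occurring in \<open>X\<close>, includes the whole size if the alphabet has no greatest letter.
\<close>
definition cuts :: "'a::linorder multiset \<Rightarrow> nat set" where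
  "cuts X = range (\<lambda>a. size {#x \<in># X. x < a#})"

definition monomial_mset :: "monomial \<Rightarrow> nat multiset" where
  "monomial_mset m = Abs_multiset (Poly_Mapping.lookup m)"

lemma count_monomial_mset: "count (monomial_mset m) = Poly_Mapping.lookup m"
  unfolding monomial_mset_def using finite_lookup[of m] by (intro count_Abs_multiset) simp

lemma set_monomial_mset: "set_mset (monomial_mset m) = Poly_Mapping.keys m"
  by (auto simp: set_mset_def count_monomial_mset in_keys_iff)

lemma ex_monomial_mset: obtains m where "monomial_mset m = X"
proof
  have "finite {x. count X x \<noteq> 0}"
    by simp
  then have "count (monomial_mset (Abs_poly_mapping (count X))) = count X"
    unfolding count_monomial_mset by (rule lookup_Abs_poly_mapping)
  then show "monomial_mset (Abs_poly_mapping (count X)) = X"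
    by (simp only: count_inject)
qed

lemma image_mset_monomial_mset_map_key:
  assumes "bij \<sigma>"
  shows "image_mset \<sigma> (monomial_mset (Poly_Mapping.map_key \<sigma> m)) = monomial_mset m"
proof (rule multiset_eqI)
  fix x
  have inj: "inj \<sigma>"
    using assms by (rule bij_is_inj)
  let ?Z = "monomial_mset (Poly_Mapping.map_key \<sigma> m)"
  have "\<sigma> -` {\<sigma> (inv \<sigma> x)} = {inv \<sigma> x}"
    using inj by (simp add: inj_vimage_singleton vimage_def inj_eq)
  then have "count (image_mset \<sigma> ?Z) (\<sigma> (inv \<sigma> x)) = count ?Z (inv \<sigma> x)"
    by (cases "inv \<sigma> x \<in># ?Z") (simp_all add: count_image_mset not_in_iff)
  also have "\<dots> = Poly_Mapping.lookup m (\<sigma> (inv \<sigma> x))"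
    using inj by (simp add: count_monomial_mset map_key.rep_eq)
  finally have "count (image_mset \<sigma> ?Z) (\<sigma> (inv \<sigma> x)) = Poly_Mapping.lookup m (\<sigma> (inv \<sigma> x))" .
  then show "count (image_mset \<sigma> (monomial_mset (Poly_Mapping.map_key \<sigma> m))) x = count (monomial_mset m) x"
    using assms by (simp add: count_monomial_mset bij_is_surj surj_f_inv_f)
qed

text \<open>
  The only composition \<open>\<alpha>\<close> such that the monomial \<open>m\<close> occurs in \<open>M\<^sub>\<alpha>\<close>, see \<open>monomial_qsym_eq\<close>.
\<close>
definition exponents :: "monomial \<Rightarrow> nat list" where
  "exponents m = map (Poly_Mapping.lookup m) (sorted_list_of_set (Poly_Mapping.keys m))"

lemma lookup_monomial_of:
  assumes "length ixs = length \<alpha>" and "distinct ixs"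
  shows "k < length \<alpha> \<Longrightarrow> Poly_Mapping.lookup (monomial_of \<alpha> ixs) (ixs ! k) = \<alpha> ! k"
    and "x \<notin> set ixs \<Longrightarrow> Poly_Mapping.lookup (monomial_of \<alpha> ixs) x = 0"
proof -
  have lookup: "Poly_Mapping.lookup (monomial_of \<alpha> ixs) x = (\<Sum>k<length \<alpha>. if ixs ! k = x then \<alpha> ! k else 0)" for x
    by (simp add: monomial_of_def lookup_sum lookup_single when_def)
  show "x \<notin> set ixs \<Longrightarrow> Poly_Mapping.lookup (monomial_of \<alpha> ixs) x = 0"
    using assms unfolding lookup by (intro sum.neutral) auto
  assume k: "k < length \<alpha>"
  then have "(\<Sum>l<length \<alpha>. if ixs ! l = ixs ! k then \<alpha> ! l else 0) = (\<Sum>l<length \<alpha>. if l = k then \<alpha> ! l else 0)"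
    using assms by (intro sum.cong) (auto simp: nth_eq_iff_index_eq)
  then show "Poly_Mapping.lookup (monomial_of \<alpha> ixs) (ixs ! k) = \<alpha> ! k"
    using k by (simp add: lookup)
qed

lemma monomial_of_eq_iff:
  assumes pos: "\<forall>a \<in> set \<alpha>. a > 0"
  shows "length ixs = length \<alpha> \<and> sorted_wrt (<) ixs \<and> monomial_of \<alpha> ixs = m \<longleftrightarrow>
    ixs = sorted_list_of_set (Poly_Mapping.keys m) \<and> \<alpha> = exponents m"
proof (intro iffI; elim conjE)
  assume len: "length ixs = length \<alpha>" and sorted: "sorted_wrt (<) ixs" and m: "monomial_of \<alpha> ixs = m"
  have dist: "distinct ixs"
    using sorted by (simp add: strict_sorted_iff)
  note lookup = lookup_monomial_of[OF len dist, unfolded m]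
  have "x \<in> Poly_Mapping.keys m" if "x \<in> set ixs" for x
  proof -
    obtain k where "k < length \<alpha>" "x = ixs ! k"
      using \<open>x \<in> set ixs\<close> len by (metis in_set_conv_nth)
    then show ?thesis
      using lookup(1)[of k] pos by (auto simp: in_keys_iff)
  qed
  then have "Poly_Mapping.keys m = set ixs"
    using lookup(2) by (auto simp: in_keys_iff)
  then have ixs: "sorted_list_of_set (Poly_Mapping.keys m) = ixs"
    using sorted by (simp add: strict_sorted_iff sorted_list_of_set.idem_if_sorted_distinct)
  moreover have "\<alpha> = exponents m"
    using lookup(1) len by (intro nth_equalityI) (simp_all add: exponents_def ixs)
  ultimately show "ixs = sorted_list_of_set (Poly_Mapping.keys m) \<and> \<alpha> = exponents m"
    by simp
next
  assume ixs: "ixs = sorted_list_of_set (Poly_Mapping.keys m)" and \<alpha>: "\<alpha> = exponents m"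
  have len: "length ixs = length \<alpha>"
    by (simp add: ixs \<alpha> exponents_def)
  have "sorted_wrt (<) ixs"
    by (simp add: ixs)
  moreover have dist: "distinct ixs"
    by (simp add: ixs)
  have "monomial_of \<alpha> ixs = m"
  proof (rule poly_mapping_eqI)
    fix x
    show "Poly_Mapping.lookup (monomial_of \<alpha> ixs) x = Poly_Mapping.lookup m x"
    proof (cases "x \<in> set ixs")
      case True
      then obtain k where k: "k < length \<alpha>" "x = ixs ! k"
        using len by (metis in_set_conv_nth)
      then show ?thesis
        using lookup_monomial_of(1)[OF len dist k(1)] by (simp add: \<alpha> exponents_def ixs)
    next
      case False
      then show ?thesis
        using lookup_monomial_of(2)[OF len dist] by (simp add: ixs in_keys_iff)
    qed
  qed
  ultimately show "length ixs = length \<alpha> \<and> sorted_wrt (<) ixs \<and> monomial_of \<alpha> ixs = m"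
    using len by simp
qed

lemma monomial_qsym_eq:
  assumes "\<forall>a \<in> set \<alpha>. a > 0"
  shows "monomial_qsym \<alpha> m = (if \<alpha> = exponents m then 1 else 0)"
  unfolding monomial_qsym_def monomial_of_eq_iff[OF assms] by simp

lemma fundamental_qsym_eq:
  "fundamental_qsym \<alpha> m = (if exponents m \<in> refinements \<alpha> then 1 else 0)"
proof -
  have "fundamental_qsym \<alpha> m = (\<Sum>\<beta> \<in> refinements \<alpha>. if \<beta> = exponents m then 1 else 0)"
    unfolding fundamental_qsym_def
    by (intro sum.cong monomial_qsym_eq) (auto simp: refinements_def is_composition_def)
  then show ?thesis
    by (simp add: finite_refinements)
qed

lemma zero_in_psums: "0 \<in> psums xs"
  unfolding psums_def by (rule image_eqI[of _ _ 0]) auto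

lemma sum_list_in_psums: "sum_list xs \<in> psums xs"
  unfolding psums_def by (rule image_eqI[of _ _ "length xs"]) auto

text \<open>
  The first part \<open>a\<close> of \<open>\<alpha>\<close> is a partial sum of \<open>\<beta>\<close>, which yields the first block; removing \<open>a\<close> and this
  block shifts both sets of partial sums by \<open>a\<close>. A partial sum of \<open>\<beta>\<close> that ends inside the first block
  can only be met by the partial sum \<open>0\<close> of the remaining parts.
\<close>
lemma refinement_if_psums_subset:
  assumes "sum_list \<beta> = sum_list \<alpha>" and "\<forall>b \<in> set \<beta>. b > 0" and "psums \<alpha> \<subseteq> psums \<beta>"
  shows "\<exists>bs. \<beta> = concat bs \<and> \<alpha> = map sum_list bs"
  using assms
proof (induction \<alpha> arbitrary: \<beta>)
  case Nil
  then have "\<beta> = []"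
    by (cases \<beta>) auto
  then show ?case
    by (intro exI[of _ "[]"]) simp
next
  case (Cons a \<alpha>)
  have "a \<in> psums (a # \<alpha>)"
    unfolding psums_def by (rule image_eqI[of _ _ 1]) auto
  then obtain k where k: "a = sum_list (take k \<beta>)"
    using Cons.prems(3) unfolding psums_def by blast
  have split: "sum_list \<beta> = a + sum_list (drop k \<beta>)"
    using k by (metis append_take_drop_id sum_list_append)
  have "psums \<alpha> \<subseteq> psums (drop k \<beta>)"
  proof
    fix x assume "x \<in> psums \<alpha>"
    then obtain i where "x = sum_list (take i \<alpha>)"
      unfolding psums_def by blast
    then have "a + x \<in> psums (a # \<alpha>)"
      unfolding psums_def by (intro image_eqI[of _ _ "Suc i"]) auto
    then obtain j where j: "a + x = sum_list (take j \<beta>)"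
      using Cons.prems(3) unfolding psums_def by blast
    show "x \<in> psums (drop k \<beta>)"
    proof (cases "k \<le> j")
      case True
      then have "take j \<beta> = take k \<beta> @ take (j - k) (drop k \<beta>)"
        by (metis le_add_diff_inverse take_add)
      then have "x = sum_list (take (j - k) (drop k \<beta>))"
        using j k by simp
      then show ?thesis
        unfolding psums_def by blast
    next
      case False
      then have "take k \<beta> = take j \<beta> @ take (k - j) (drop j \<beta>)"
        by (metis le_add_diff_inverse nat_le_linear take_add)
      then have "x = 0"
        using j k by simp
      then show ?thesis
        by (simp add: zero_in_psums)
    qed
  qed
  moreover have "sum_list (drop k \<beta>) = sum_list \<alpha>" "\<forall>b \<in> set (drop k \<beta>). b > 0"
    using split Cons.prems(1,2) by (auto dest: in_set_dropD)
  ultimately obtain bs where "drop k \<beta> = concat bs" "\<alpha> = map sum_list bs"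
    using Cons.IH by blast
  then show ?case
    using k by (intro exI[of _ "take k \<beta> # bs"]) (simp flip: \<open>drop k \<beta> = concat bs\<close>)
qed

lemma sum_list_concat_nat: "sum_list (concat bs) = sum_list (map sum_list bs)"
  by (induction bs) simp_all

text \<open>
  Refinement becomes an inclusion of sets. For \<open>\<alpha> = co n D\<close> the set on the left is \<open>D\<close> together with
  \<open>0\<close> and \<open>n\<close> (\<open>psums_co\<close>), which is how descent sets enter.
\<close>
lemma mem_refinements_iff_psums:
  "\<beta> \<in> refinements \<alpha> \<longleftrightarrow> is_composition (sum_list \<alpha>) \<beta> \<and> psums \<alpha> \<subseteq> psums \<beta>"
proof
  assume "\<beta> \<in> refinements \<alpha>"
  then obtain bs where bs: "\<beta> = concat bs" "\<alpha> = map sum_list bs" and comp: "is_composition (sum_list \<alpha>) \<beta>"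
    by (auto simp: refinements_def)
  have "sum_list (take k \<alpha>) \<in> psums \<beta>" for k
  proof -
    have "sum_list (take k \<alpha>) = sum_list (concat (take k bs))"
      by (simp add: bs(2) take_map sum_list_concat_nat)
    also have "concat (take k bs) = take (length (concat (take k bs))) \<beta>"
      unfolding bs(1) by (metis append_eq_conv_conj append_take_drop_id concat_append)
    finally show ?thesis
      unfolding psums_def by blast
  qed
  then show "is_composition (sum_list \<alpha>) \<beta> \<and> psums \<alpha> \<subseteq> psums \<beta>"
    using comp by (auto simp: psums_def)
next
  assume "is_composition (sum_list \<alpha>) \<beta> \<and> psums \<alpha> \<subseteq> psums \<beta>"
  then show "\<beta> \<in> refinements \<alpha>"
    using refinement_if_psums_subset[of \<beta> \<alpha>] by (auto simp: refinements_def is_composition_def)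
qed

lemma sum_list_take_differences:
  fixes js :: "nat list"
  assumes "sorted (x # js @ [n])" and "k \<le> Suc (length js)"
  shows "x + sum_list (take k (map2 (-) (js @ [n]) (x # js))) = (x # js @ [n]) ! k"
  using assms
proof (induction js arbitrary: x k)
  case Nil
  then show ?case
    by (cases k) auto
next
  case (Cons j js)
  show ?case
  proof (cases k)
    case (Suc k')
    then show ?thesis
      using Cons.IH[of j k'] Cons.prems by simp
  qed simp
qed

lemma psums_co:
  assumes "D \<subseteq> {1..n - 1}"
  shows "psums (co n D) = {0, n} \<union> D" and "sum_list (co n D) = n"
proof -
  let ?js = "sorted_list_of_set D"
  have "finite D"
    using assms by (rule finite_subset) simp
  then have D: "finite D" "set ?js = D"
    by simp_all
  have "d \<le> n" if "d \<in> D" for d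
    using assms that by (meson atLeastAtMost_iff diff_le_self le_trans subsetD)
  then have sorted: "sorted (0 # ?js @ [n])"
    using D by (simp add: sorted_append)
  have len: "length (co n D) = Suc (length ?js)"
    by (simp add: co_def Let_def)
  have sum: "sum_list (take k (co n D)) = (0 # ?js @ [n]) ! k" if "k \<le> Suc (length ?js)" for k
    using sum_list_take_differences[OF sorted that] by (simp add: co_def Let_def)
  show "sum_list (co n D) = n"
    using sum[of "Suc (length ?js)"] len by (simp add: nth_append)
  have "psums (co n D) = (\<lambda>k. sum_list (take k (co n D))) ` {..Suc (length ?js)}"
    unfolding psums_def
  proof (intro equalityI subsetI)
    fix x assume "x \<in> range (\<lambda>k. sum_list (take k (co n D)))"
    then obtain k where "x = sum_list (take k (co n D))"
      by blast
    then have "x = sum_list (take (min k (length (co n D))) (co n D))"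
      by (simp add: min_def)
    then show "x \<in> (\<lambda>k. sum_list (take k (co n D))) ` {..Suc (length ?js)}"
      unfolding len by (intro image_eqI) auto
  qed auto
  also have "\<dots> = (!) (0 # ?js @ [n]) ` {..<length (0 # ?js @ [n])}"
    using sum by (intro image_cong) auto
  also have "\<dots> = set (0 # ?js @ [n])"
    unfolding set_conv_nth by (simp add: image_def lessThan_def) blast
  finally show "psums (co n D) = {0, n} \<union> D"
    using D by auto
qed

text \<open>
  The initial pieces of the support of a monomial, once by number of variables and once by a bound on
  the variables; this relates \<open>psums\<close> to \<open>cuts\<close>.
\<close>
lemma set_take_strict_sorted_eq_less:
  fixes ks :: "nat list"
  assumes "sorted_wrt (<) ks"
  shows "range (\<lambda>k. set (take k ks)) = range (\<lambda>a. {x \<in> set ks. x < a})"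
proof (intro equalityI subsetI; clarify)
  fix k
  show "set (take k ks) \<in> range (\<lambda>a. {x \<in> set ks. x < a})"
  proof (cases "k < length ks")
    case True
    have mem: "ks ! i \<in> set (take k ks) \<longleftrightarrow> ks ! i < ks ! k" if "i < length ks" for i
    proof -
      have "ks ! i < ks ! k \<longleftrightarrow> i < k"
        using sorted_wrt_nth_less[OF assms, of i k] sorted_wrt_nth_less[OF assms, of k i] True that
        by (metis less_asym less_irrefl neqE)
      moreover have "ks ! i \<in> set (take k ks) \<longleftrightarrow> i < k"
        using assms that True
        by (auto simp: in_set_conv_nth strict_sorted_iff nth_eq_iff_index_eq)
      ultimately show ?thesis
        by simp
    qed
    have "set (take k ks) = {x \<in> set ks. x < ks ! k}"
    proof (intro set_eqI)
      fix x
      show "x \<in> set (take k ks) \<longleftrightarrow> x \<in> {x \<in> set ks. x < ks ! k}"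
      proof (cases "x \<in> set ks")
        case True
        then obtain i where "i < length ks" "x = ks ! i"
          by (metis in_set_conv_nth)
        then show ?thesis
          using mem by simp
      qed (auto dest: in_set_takeD)
    qed
    then show ?thesis
      by blast
  next
    case False
    then have "set (take k ks) = {x \<in> set ks. x < Suc (Max (set ks))}"
      by (auto simp: less_Suc_eq_le)
    then show ?thesis
      by blast
  qed
next
  fix a
  have "\<exists>k. set (take k ks) = {x \<in> set ks. x < a}"
    using assms
  proof (induction ks)
    case (Cons y ks)
    show ?case
    proof (cases "y < a")
      case True
      obtain k where "set (take k ks) = {x \<in> set ks. x < a}"
        using Cons by auto
      then show ?thesis
        using True by (intro exI[of _ "Suc k"]) auto
    next
      case False
      then show ?thesis
        using Cons.prems by (intro exI[of _ 0]) auto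
    qed
  qed simp
  then show "{x \<in> set ks. x < a} \<in> range (\<lambda>k. set (take k ks))"
    by (metis rangeI)
qed

lemma psums_exponents: "psums (exponents m) = cuts (monomial_mset m)"
proof -
  let ?ks = "sorted_list_of_set (Poly_Mapping.keys m)"
  have "psums (exponents m) = (\<lambda>A. sum (Poly_Mapping.lookup m) A) ` range (\<lambda>k. set (take k ?ks))"
    by (simp add: psums_def exponents_def take_map sum_list_distinct_conv_sum_set image_image)
  also have "\<dots> = (\<lambda>A. sum (Poly_Mapping.lookup m) A) ` range (\<lambda>a. {x \<in> Poly_Mapping.keys m. x < a})"
    by (subst set_take_strict_sorted_eq_less) simp_all
  also have "\<dots> = cuts (monomial_mset m)"
    unfolding cuts_def image_image
  proof (rule image_cong)
    fix a
    have "set_mset {#x \<in># monomial_mset m. x < a#} = {x \<in> Poly_Mapping.keys m. x < a}"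
      by (auto simp: set_monomial_mset)
    then show "sum (Poly_Mapping.lookup m) {x \<in> Poly_Mapping.keys m. x < a} = size {#x \<in># monomial_mset m. x < a#}"
      by (simp add: size_multiset_overloaded_eq count_monomial_mset)
  qed simp
  finally show ?thesis .
qed

lemma sum_list_exponents: "sum_list (exponents m) = size (monomial_mset m)"
  by (simp add: exponents_def sum_list_distinct_conv_sum_set size_multiset_overloaded_eq
      count_monomial_mset set_monomial_mset)

lemma is_composition_exponents: "is_composition n (exponents m) \<longleftrightarrow> size (monomial_mset m) = n"
proof -
  have "\<forall>a \<in> set (exponents m). a > 0"
    by (auto simp: exponents_def in_keys_iff)
  then show ?thesis
    by (simp add: is_composition_def sum_list_exponents)
qed

text \<open>
  The letters below \<open>a\<close> occupy an initial segment of the sorted word. If it ends at \<open>i\<close>, the word steps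
  up after \<open>i\<close>; conversely, the letter after a step up serves as \<open>a\<close>.
\<close>
lemma mem_cuts_iff_letter:
  assumes i: "i \<in> {1..size X - 1}"
  shows "i \<in> cuts X \<longleftrightarrow> letter X i \<noteq> letter X (i + 1)"
proof -
  let ?S = "\<lambda>a. {k \<in> {1..size X}. letter X k < a}"
  have size_less: "size {#x \<in># X. x < a#} = card (?S a)" for a
  proof -
    have "{#x \<in># X. x < a#} = {#x \<in># image_mset (letter X) (mset_set {1..size X}). x < a#}"
      by (simp only: image_mset_letter)
    then show ?thesis
      by (simp add: filter_mset_image_mset)
  qed
  have down: "letter X k < a" if "letter X l < a" "1 \<le> k" "k \<le> l" "l \<le> size X" for k l a
    using le_less_trans[OF letter_mono[of k l X]] that by simp
  have le: "letter X i \<le> letter X (i + 1)"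
    using i by (intro letter_mono) auto
  show ?thesis
  proof
    assume "letter X i \<noteq> letter X (i + 1)"
    then have "letter X i < letter X (i + 1)"
      using le by simp
    then have "letter X k < letter X (i + 1) \<longleftrightarrow> k \<le> i" if "k \<in> {1..size X}" for k
      using that i down[of i "letter X (i + 1)" k] letter_mono[of "i + 1" k X] by (cases "k \<le> i") auto
    then have "?S (letter X (i + 1)) = {1..i}"
      using i by auto
    then have "i = size {#x \<in># X. x < letter X (i + 1)#}"
      by (simp add: size_less)
    then show "i \<in> cuts X"
      unfolding cuts_def by blast
  next
    assume "i \<in> cuts X"
    then obtain a where a: "i = card (?S a)"
      by (auto simp: cuts_def size_less)
    show "letter X i \<noteq> letter X (i + 1)"
    proof
      assume eq: "letter X i = letter X (i + 1)"
      show False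
      proof (cases "letter X i < a")
        case True
        then have "{1..i + 1} \<subseteq> ?S a"
          using eq i down[of "i + 1" a] by auto
        then have "card {1..i + 1} \<le> card (?S a)"
          by (intro card_mono) auto
        then show False
          using a by simp
      next
        case False
        have "k < i" if "k \<in> ?S a" for k
          using False down[of k a i] that i by (cases "k < i") auto
        then have "?S a \<subseteq> {1..<i}"
          by auto
        then have "card (?S a) \<le> card {1..<i}"
          by (intro card_mono) auto
        then have "i \<le> card {1..<i}"
          by (rule ord_eq_le_trans[OF a])
        then show False
          using i by auto
      qed
    qed
  qed
qed

lemma fundamental_qsym_co:
  assumes D: "D \<subseteq> {1..n - 1}"
  shows "fundamental_qsym (co n D) m =
    (if size (monomial_mset m) = n \<and> D \<subseteq> cuts (monomial_mset m) then 1 else 0)"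
proof -
  have "exponents m \<in> refinements (co n D) \<longleftrightarrow>
      size (monomial_mset m) = n \<and> {0, n} \<union> D \<subseteq> cuts (monomial_mset m)"
    by (simp add: mem_refinements_iff_psums psums_co[OF D] is_composition_exponents psums_exponents)
  moreover have "{0, size (monomial_mset m)} \<subseteq> cuts (monomial_mset m)"
    using zero_in_psums[of "exponents m"] sum_list_in_psums[of "exponents m"]
    by (simp add: psums_exponents sum_list_exponents)
  ultimately show ?thesis
    by (auto simp: fundamental_qsym_eq)
qed

lemma fundamental_qsym_co_Des:
  assumes "\<pi> permutes {1..n}"
  shows "fundamental_qsym (co n (Des n \<pi>)) m =
    (if size (monomial_mset m) = n \<and> compatible \<pi> (monomial_mset m) then 1 else 0)"
proof -
  have Des: "Des n \<pi> \<subseteq> {1..n - 1}"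
    by (auto simp: Des_def)
  have "Des n \<pi> \<subseteq> cuts (monomial_mset m) \<longleftrightarrow> compatible \<pi> (monomial_mset m)"
    if "size (monomial_mset m) = n"
    unfolding compatible_iff_Des[OF assms that]
    using mem_cuts_iff_letter[of _ "monomial_mset m"] Des that by blast
  then show ?thesis
    by (simp add: fundamental_qsym_co[OF Des] cong: conj_cong)
qed

lemma Q_eq_compatible_count:
  assumes "\<forall>\<pi> \<in># B. \<pi> permutes {1..n}"
  shows "Q n B m =
    (if size (monomial_mset m) = n then int (compatible_count B (monomial_mset m)) else 0)"
  using assms by (induction B) (simp_all add: Q_def compatible_count_def fundamental_qsym_co_Des)

section \<open>Symmetric multisets of permutations\<close>

text \<open>
  Monomials of degree other than \<open>n\<close> do not occur in \<open>Q(B)\<close>, and \<open>map_key \<sigma>\<close> undoes the renaming of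
  variables by \<open>\<sigma>\<close>.
\<close>
lemma symmetric_mset_iff:
  assumes B: "\<forall>\<pi> \<in># B. \<pi> permutes {1..n}"
  shows "symmetric_mset n B \<longleftrightarrow> rearrangement_invariant n B"
proof
  assume sym: "symmetric_mset n B"
  show "rearrangement_invariant n B"
    unfolding rearrangement_invariant_def
  proof (intro allI impI)
    fix \<sigma> :: "nat \<Rightarrow> nat" and X :: "nat multiset"
    assume \<sigma>: "bij \<sigma>" and X: "size X = n"
    obtain m where m: "monomial_mset m = image_mset \<sigma> X"
      by (rule ex_monomial_mset)
    have "image_mset \<sigma> (monomial_mset (Poly_Mapping.map_key \<sigma> m)) = image_mset \<sigma> X"
      using image_mset_monomial_mset_map_key[OF \<sigma>] m by simp
    then have "monomial_mset (Poly_Mapping.map_key \<sigma> m) = X"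
      using multiset.inj_map[OF bij_is_inj[OF \<sigma>]] by (simp add: inj_eq)
    moreover have "Q n B (Poly_Mapping.map_key \<sigma> m) = Q n B m"
      using sym \<sigma> by (simp add: symmetric_mset_def symmetric_function_def permute_vars_def fun_eq_iff)
    ultimately show "compatible_count B (image_mset \<sigma> X) = compatible_count B X"
      using X by (simp add: Q_eq_compatible_count[OF B] m)
  qed
next
  assume inv: "rearrangement_invariant n B"
  have "Q n B (Poly_Mapping.map_key \<sigma> m) = Q n B m" if \<sigma>: "bij \<sigma>" for \<sigma> m
  proof -
    let ?Z = "monomial_mset (Poly_Mapping.map_key \<sigma> m)"
    have m: "monomial_mset m = image_mset \<sigma> ?Z"
      using image_mset_monomial_mset_map_key[OF \<sigma>] by simp
    have "compatible_count B (image_mset \<sigma> ?Z) = compatible_count B ?Z" if "size ?Z = n"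
      using inv \<sigma> that unfolding rearrangement_invariant_def by blast
    then show ?thesis
      by (simp add: Q_eq_compatible_count[OF B] m)
  qed
  then show "symmetric_mset n B"
    by (simp add: symmetric_mset_def symmetric_function_def permute_vars_def)
qed

theorem corollary3p6:
  fixes n :: nat and B :: "(nat \<Rightarrow> nat) multiset" and J :: "nat set"
  assumes "n \<ge> 1"
    and "\<forall>\<pi> \<in># B. \<pi> permutes {1..n}"
    and "J \<subseteq> {1..n - 1}"
    and "symmetric_mset n B"
  shows "symmetric_mset n (perm_mset_prod (mset_set (inv_J_class n J)) B) \<and>
         symmetric_mset n (perm_mset_prod B (mset_set (inv_J_class n J)))"
proof -
  have R: "\<sigma> permutes {1..n}" if "\<sigma> \<in> inv_J_class n J" for \<sigma>
    using that by (auto simp: inv_J_class_def intro: permutes_inv)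
  have "rearrangement_invariant n B"
    using assms(2,4) by (simp add: symmetric_mset_iff)
  note invariant = rearrangement_invariant_prod[OF assms(2) this assms(3)]
  have "\<forall>\<pi> \<in># perm_mset_prod (mset_set (inv_J_class n J)) B. \<pi> permutes {1..n}"
    and "\<forall>\<pi> \<in># perm_mset_prod B (mset_set (inv_J_class n J)). \<pi> permutes {1..n}"
    using R assms(2) by (auto simp: perm_mset_prod_def finite_inv_J_class intro: permutes_compose)
  then show ?thesis
    using invariant by (simp add: symmetric_mset_iff)
qed

end
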